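(* Let $m\ge 0$ and $\kappa\ge 1$ be integers and let $\gamma=2(m+1)$. Consider all balanced partitionings of the $\gamma\times\kappa$ all-ones protograph matrix $\mathbf{H}^{\mathrm{p}}$ into $m+1$ component matrices $\mathbf{H}^{\mathrm{p}}_0,\dots,\mathbf{H}^{\mathrm{p}}_m$, i.e. partitionings in which, for every column of $\mathbf{H}^{\mathrm{p}}$ and every $y\in\{0,\dots,m\}$, exactly two of the $\gamma$ elements of that column are assigned to $\mathbf{H}^{\mathrm{p}}_y$. Then the minimum, over all such balanced partitionings, of the overall overlap $t$ is $$t_{\min}=\left\lceil \frac{\kappa}{\binom{\gamma}{2}}\right\rceil .$$
   Context: The protograph matrix of the underlying block code of a spatially-coupled (SC) code with column weight $\gamma$ and row weight $\kappa$ is the $\gamma\times\kappa$ matrix $\mathbf{H}^{\mathrm{p}}$ all of whose entries equal $1$. The integer $m$ is the memory of the SC code. A partitioning of $\mathbf{H}^{\mathrm{p}}$ into $m+1$ component matrices is described by a partitioning matrix $\mathbf{PM}=[h_{i,j}]$ of size $\gamma\times\kappa$ with entries $h_{i,j}\in\{0,\dots,m\}$. The entry of $\mathbf{H}^{\mathrm{p}}$ at position $(i,j)$ is assigned to the component matrix $\mathbf{H}^{\mathrm{p}}_{h_{i,j}}$. That is, for each $y\in\{0,\dots,m\}$, $\mathbf{H}^{\mathrm{p}}_y$ is the $\gamma\times\kappa$ $0/1$-matrix whose $(i,j)$ entry is $1$ if and only if $h_{i,j}=y$, so that $\mathbf{H}^{\mathrm{p}}=\sum_{y=0}^{m}\mathbf{H}^{\mathrm{p}}_y$.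 The overlap between two distinct rows of a matrix is the number of columns in which both rows have non-zero values. For $y\in\{0,\dots,m\}$, $t_y$ denotes the maximum overlap over all pairs of distinct rows of $\mathbf{H}^{\mathrm{p}}_y$. The overall overlap of the partitioning is $t=\max_{y\in\{0,\dots,m\}}t_y$. *)

theory Defs
  imports Complex_Main "Jordan_Normal_Form.Matrix"
begin

definition protograph :: "nat \<Rightarrow> nat \<Rightarrow> nat mat" where
  "protograph \<gamma> \<kappa> = mat \<gamma> \<kappa> (\<lambda>_. 1)"

definition partitioning_matrix :: "nat \<Rightarrow> nat \<Rightarrow> nat \<Rightarrow> nat mat \<Rightarrow> bool" where
  "partitioning_matrix m \<gamma> \<kappa> PM \<longleftrightarrow>
     PM \<in> carrier_mat \<gamma> \<kappa> \<and> (\<forall>i<\<gamma>. \<forall>j<\<kappa>. PM $$ (i, j) \<le> m)"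

definition component_matrix :: "nat mat \<Rightarrow> nat \<Rightarrow> nat mat" where
  "component_matrix PM y =
     mat (dim_row PM) (dim_col PM) (\<lambda>(i, j). if PM $$ (i, j) = y then 1 else 0)"

lemma sum_component_matrix:
  assumes "partitioning_matrix m \<gamma> \<kappa> PM" and "i < \<gamma>" and "j < \<kappa>"
  shows "(\<Sum>y\<le>m. component_matrix PM y $$ (i, j)) = protograph \<gamma> \<kappa> $$ (i, j)"
  using assms by (auto simp: partitioning_matrix_def component_matrix_def protograph_def)

definition balanced_partitioning :: "nat \<Rightarrow> nat \<Rightarrow> nat \<Rightarrow> nat mat \<Rightarrow> bool" where
  "balanced_partitioning m \<gamma> \<kappa> PM \<longleftrightarrow>
     partitioning_matrix m \<gamma> \<kappa> PM \<and>
     (\<forall>j<\<kappa>. \<forall>y\<le>m. card {i. i < \<gamma> \<and> PM $$ (i, j) = y} = 2)"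

definition row_overlap :: "'a::zero mat \<Rightarrow> nat \<Rightarrow> nat \<Rightarrow> nat" where
  "row_overlap A i i' = card {j. j < dim_col A \<and> A $$ (i, j) \<noteq> 0 \<and> A $$ (i', j) \<noteq> 0}"

text \<open>Meaningful for matrices with at least two rows; otherwise the maximum ranges over the
  empty set.\<close>

definition max_overlap :: "'a::zero mat \<Rightarrow> nat" where
  "max_overlap A = Max {row_overlap A i i' | i i'. i < dim_row A \<and> i' < dim_row A \<and> i \<noteq> i'}"

definition overall_overlap :: "nat \<Rightarrow> nat mat \<Rightarrow> nat" where
  "overall_overlap m PM = Max ((\<lambda>y. max_overlap (component_matrix PM y)) ` {0..m})"

text \<open>Both clauses are needed: \<open>Min\<close> or \<open>Inf\<close> alone would not assert that the set is nonempty.\<close>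

definition is_minimum :: "'a::ord set \<Rightarrow> 'a \<Rightarrow> bool" where
  "is_minimum S t \<longleftrightarrow> t \<in> S \<and> (\<forall>s\<in>S. t \<le> s)"

end

(* In each column the elements assigned to one component form a pair of rows, so distributing the
   \<kappa> columns over the binomial(\<gamma>,2) pairs gives the lower bound. For the upper bound, take the
   round-robin one-factorization of the complete graph on \<gamma> = 2(m+1) vertices. It has 2m+1 perfect
   matchings of m+1 edges each; combining every matching with the m+1 cyclic shifts of the edge
   labels 0, ..., m gives (2m+1)(m+1) = binomial(\<gamma>,2) columns in which each component meets every
   pair of rows exactly once. Repeat these columns periodically. *)

theory Submission imports Defs "HOL-Number_Theory.Cong" begin

section \<open>Overlap as a bound on column counts for pairs of rows\<close>

lemma row_overlap_component_matrix:
  assumes "PM \<in> carrier_mat \<gamma> \<kappa>" "i < \<gamma>" "i' < \<gamma>"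
  shows "row_overlap (component_matrix PM y) i i'
    = card {j. j < \<kappa> \<and> PM $$ (i, j) = y \<and> PM $$ (i', j) = y}"
  unfolding row_overlap_def component_matrix_def
  using assms by (intro arg_cong[where f = card]) (auto split: if_splits)

lemma overall_overlap_le_iff:
  assumes "PM \<in> carrier_mat \<gamma> \<kappa>" "\<gamma> \<ge> 2"
  shows "overall_overlap m PM \<le> t \<longleftrightarrow>
    (\<forall>y\<le>m. \<forall>i<\<gamma>. \<forall>i'<\<gamma>. i \<noteq> i' \<longrightarrow>
      card {j. j < \<kappa> \<and> PM $$ (i, j) = y \<and> PM $$ (i', j) = y} \<le> t)"
proof -
  have "max_overlap (component_matrix PM y) \<le> t \<longleftrightarrow>
      (\<forall>i<\<gamma>. \<forall>i'<\<gamma>. i \<noteq> i' \<longrightarrow> row_overlap (component_matrix PM y) i i' \<le> t)" for y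
  proof -
    define S where "S = {row_overlap (component_matrix PM y) i i' | i i'.
        i < dim_row (component_matrix PM y) \<and> i' < dim_row (component_matrix PM y) \<and> i \<noteq> i'}"
    have dim: "dim_row (component_matrix PM y) = \<gamma>"
      using assms(1) by (simp add: component_matrix_def)
    have "S \<subseteq> (\<lambda>(i, i'). row_overlap (component_matrix PM y) i i') ` ({..<\<gamma>} \<times> {..<\<gamma>})"
      unfolding S_def dim by auto
    then have fin: "finite S"
      by (rule finite_subset) auto
    \<comment> \<open>Two rows exist, so \<open>Max\<close> is taken over a nonempty set.\<close>
    have "row_overlap (component_matrix PM y) 0 1 \<in> S"
      unfolding S_def dim using assms(2) by force
    then have "S \<noteq> {}"
      by blast
    with fin have "Max S \<le> t \<longleftrightarrow> (\<forall>s\<in>S. s \<le> t)"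
      by simp
    then show ?thesis
      unfolding max_overlap_def S_def[symmetric] by (auto simp: S_def dim)
  qed
  then show ?thesis
    using row_overlap_component_matrix[OF assms(1)]
    by (auto simp: overall_overlap_def Max_le_iff)
qed

section \<open>Lower bound\<close>

text \<open>Pigeonhole on component 0: every column selects a pair of rows, and the columns that
  select a given pair all count towards the overlap of these two rows.\<close>

lemma columns_le_overall_overlap:
  assumes "balanced_partitioning m \<gamma> \<kappa> PM" "\<gamma> \<ge> 2"
  shows "\<kappa> \<le> overall_overlap m PM * (\<gamma> choose 2)"
proof -
  define P where "P = {A. A \<subseteq> {..<\<gamma>} \<and> card A = 2}"
  define f where "f j = {i. i < \<gamma> \<and> PM $$ (i, j) = 0}" for j
  have carrier: "PM \<in> carrier_mat \<gamma> \<kappa>"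
    using assms(1) by (simp add: balanced_partitioning_def partitioning_matrix_def)
  have "finite P"
    unfolding P_def by simp
  have cardP: "card P = \<gamma> choose 2"
    unfolding P_def using n_subsets[of "{..<\<gamma>}" 2] by simp
  have f: "f j \<in> P" if "j < \<kappa>" for j
    using assms(1) that by (auto simp: P_def f_def balanced_partitioning_def)
  have fibre: "card {j. j < \<kappa> \<and> f j = A} \<le> overall_overlap m PM" if A_in: "A \<in> P" for A
  proof -
    obtain i i' where A: "A = {i, i'}" "i \<noteq> i'"
      using A_in unfolding P_def card_2_iff by blast
    with A_in have "i < \<gamma>" "i' < \<gamma>"
      by (auto simp: P_def)
    have "card {j. j < \<kappa> \<and> f j = A}
        \<le> card {j. j < \<kappa> \<and> PM $$ (i, j) = 0 \<and> PM $$ (i', j) = 0}"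
      by (rule card_mono) (auto simp: f_def A(1))
    also have "\<dots> \<le> overall_overlap m PM"
      using overall_overlap_le_iff[OF carrier assms(2), of m "overall_overlap m PM"]
        A(2) \<open>i < \<gamma>\<close> \<open>i' < \<gamma>\<close> by simp
    finally show ?thesis .
  qed
  have "{..<\<kappa>} = (\<Union>A\<in>P. {j. j < \<kappa> \<and> f j = A})"
    using f by auto
  then have "\<kappa> = card (\<Union>A\<in>P. {j. j < \<kappa> \<and> f j = A})"
    by (metis card_lessThan)
  also have "\<dots> \<le> (\<Sum>A\<in>P. card {j. j < \<kappa> \<and> f j = A})"
    by (rule card_UN_le) fact
  also have "\<dots> \<le> (\<Sum>A\<in>P. overall_overlap m PM)"
    by (rule sum_mono) (rule fibre)
  finally show ?thesis
    by (simp add: cardP mult.commute)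
qed

section \<open>Round-robin matchings of the complete graph\<close>

text \<open>Matching \<open>r\<close> of the round-robin schedule on the vertices \<open>0, \<dots>, 2m\<close> of a cycle and the point
  at infinity \<open>2m + 1\<close>: infinity is paired with \<open>r\<close> (label \<open>0\<close>), and other vertices are paired when
  they have the same distance to \<open>r\<close> on the cycle (their label).\<close>

definition round_label :: "nat \<Rightarrow> nat \<Rightarrow> nat \<Rightarrow> nat" where
  "round_label m r i =
     (if i = 2 * m + 1 then 0
      else let d = (if r \<le> i then i - r else r - i) in if d \<le> m then d else 2 * m + 1 - d)"

lemma round_label_le:
  assumes "r < 2 * m + 1" "i < 2 * (m + 1)"
  shows "round_label m r i \<le> m"
  using assms by (auto simp: round_label_def Let_def)

lemma card_round_label:
  assumes "r < 2 * m + 1" "k \<le> m"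
  shows "card {i. i < 2 * (m + 1) \<and> round_label m r i = k} = 2"
proof (cases "k = 0")
  case True
  have "{i. i < 2 * (m + 1) \<and> round_label m r i = k} = {r, 2 * m + 1}"
    using assms True by (auto simp: round_label_def Let_def split: if_splits)
  then show ?thesis
    using assms by simp
next
  case False
  \<comment> \<open>\<open>a\<close> and \<open>b\<close> are \<open>r + k\<close> and
    \<open>r - k\<close> reduced modulo \<open>2 * m + 1\<close>, the two vertices at cyclic
    distance \<open>k\<close> from \<open>r\<close>.\<close>
  define a where "a = (if r + k < 2 * m + 1 then r + k else r + k - (2 * m + 1))"
  define b where "b = (if k \<le> r then r - k else r + (2 * m + 1) - k)"
  have ab: "a < 2 * m + 1" "b < 2 * m + 1"
    using assms False by (auto simp: a_def b_def)
  have "round_label m r i = k \<longleftrightarrow> i = a \<or> i = b" if "i < 2 * m + 1" for i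
  proof -
    have "round_label m r i = k \<longleftrightarrow> i = r + k \<or> r = i + k \<or>
        i + (2 * m + 1) = r + k \<or> r + (2 * m + 1) = i + k"
      using assms False that by (cases "r \<le> i") (auto simp: round_label_def Let_def)
    also have "\<dots> \<longleftrightarrow> i = a \<or> i = b"
      using assms False that
      by (cases "r + k < 2 * m + 1"; cases "k \<le> r") (auto simp: a_def b_def)
    finally show ?thesis .
  qed
  moreover have "round_label m r (2 * m + 1) \<noteq> k"
    using False by (simp add: round_label_def)
  ultimately have "{i. i < 2 * (m + 1) \<and> round_label m r i = k} = {a, b}"
    using ab by (auto simp: less_Suc_eq)
  \<comment> \<open>Modulo \<open>2 * m + 1\<close> they differ by \<open>2 * k\<close>, and
    \<open>0 < 2 * k \<le> 2 * m\<close>.\<close>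
  moreover have "a \<noteq> b"
    using assms False by (auto simp: a_def b_def split: if_splits)
  ultimately show ?thesis
    by simp
qed

text \<open>Distinct vertices at the same distance from \<open>r\<close> are mirror images in
  \<open>r\<close>, so their sum is \<open>2 * r\<close> modulo \<open>2 * m + 1\<close>; the ranges
  leave only these three cases.\<close>

lemma round_label_eq_imp_sum:
  assumes "r < 2 * m + 1" "i < 2 * m + 1" "i' < 2 * m + 1" "i \<noteq> i'"
    and "round_label m r i = round_label m r i'"
  shows "i + i' = 2 * r \<or> i + i' = 2 * r + (2 * m + 1) \<or> i + i' + (2 * m + 1) = 2 * r"
  using assms by (auto simp: round_label_def Let_def split: if_splits)

lemma round_label_infinity:
  assumes "r < 2 * m + 1" "i < 2 * m + 1"
  shows "round_label m r i = round_label m r (2 * m + 1) \<longleftrightarrow> i = r"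
  using assms by (auto simp: round_label_def Let_def)

lemma round_unique:
  assumes r: "r < 2 * m + 1" "r' < 2 * m + 1"
    and i: "i < 2 * (m + 1)" "i' < 2 * (m + 1)" "i \<noteq> i'"
    and eq: "round_label m r i = round_label m r i'" "round_label m r' i = round_label m r' i'"
  shows "r = r'"
proof -
  consider "i = 2 * m + 1" "i' < 2 * m + 1" | "i' = 2 * m + 1" "i < 2 * m + 1"
    | "i < 2 * m + 1" "i' < 2 * m + 1"
    using i by (simp add: less_Suc_eq) metis
  then show ?thesis
  proof cases
    case 1
    with r eq show ?thesis
      using round_label_infinity by metis
  next
    case 2
    with r eq show ?thesis
      using round_label_infinity by metis
  next
    case 3
    have "2 * r = 2 * r' \<or> 2 * r = 2 * r' + (2 * m + 1) \<or> 2 * r' = 2 * r + (2 * m + 1)"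
      using round_label_eq_imp_sum[OF r(1) 3 i(3) eq(1)]
        round_label_eq_imp_sum[OF r(2) 3 i(3) eq(2)]
      by (elim disjE) (use r in auto)
    \<comment> \<open>Parity: the cycle length \<open>2 * m + 1\<close> is odd.\<close>
    moreover have "2 * r \<noteq> 2 * r' + (2 * m + 1)" "2 * r' \<noteq> 2 * r + (2 * m + 1)"
      by presburger+
    ultimately show ?thesis
      by simp
  qed
qed

section \<open>The periodic partitioning and its overlap\<close>

lemma shift_mod_inj:
  fixes b s s' n :: nat
  assumes "(b + s) mod n = (b + s') mod n" "s < n" "s' < n"
  shows "s = s'"
  using assms by (metis cong_add_lcancel_nat cong_def mod_less)

text \<open>The low digit of \<open>j\<close> in mixed radix selects the matching, the next digit
  the cyclic shift of the labels, so a period of \<open>(2 * m + 1) * (m + 1)\<close> columns runs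
  through all combinations.\<close>

definition round_robin :: "nat \<Rightarrow> nat \<Rightarrow> nat mat" where
  "round_robin m \<kappa> = mat (2 * (m + 1)) \<kappa> (\<lambda>(i, j).
     (round_label m (j mod (2 * m + 1)) i + j div (2 * m + 1) mod (m + 1)) mod (m + 1))"

lemma balanced_round_robin: "balanced_partitioning m (2 * (m + 1)) \<kappa> (round_robin m \<kappa>)"
  unfolding balanced_partitioning_def partitioning_matrix_def
proof (intro conjI allI impI)
  show "round_robin m \<kappa> \<in> carrier_mat (2 * (m + 1)) \<kappa>"
    by (simp add: round_robin_def)
next
  fix i j
  assume "i < 2 * (m + 1)" "j < \<kappa>"
  then show "round_robin m \<kappa> $$ (i, j) \<le> m"
    by (simp add: round_robin_def mod_Suc_le_divisor)
next
  fix j y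
  assume j: "j < \<kappa>" and y: "y \<le> m"
  define r where "r = j mod (2 * m + 1)"
  define s where "s = j div (2 * m + 1) mod (m + 1)"
  have r: "r < 2 * m + 1" and s: "s \<le> m"
    by (simp_all add: r_def s_def mod_Suc_le_divisor)
  \<comment> \<open>\<open>k\<close> is \<open>y - s\<close> modulo \<open>m + 1\<close>, the label
    that the shift \<open>s\<close> sends to \<open>y\<close>.\<close>
  define k where "k = (if s \<le> y then y - s else y + (m + 1) - s)"
  have "k \<le> m"
    using y s by (auto simp: k_def)
  have shift: "(b + s) mod (m + 1) = y \<longleftrightarrow> b = k" if "b \<le> m" for b
    using y s that by (auto simp: k_def mod_if split: if_splits)
  have "{i. i < 2 * (m + 1) \<and> round_robin m \<kappa> $$ (i, j) = y}
      = {i. i < 2 * (m + 1) \<and> (round_label m r i + s) mod (m + 1) = y}"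
    using j by (auto simp: round_robin_def r_def s_def)
  also have "\<dots> = {i. i < 2 * (m + 1) \<and> round_label m r i = k}"
    using shift round_label_le[OF r] by blast
  finally show "card {i. i < 2 * (m + 1) \<and> round_robin m \<kappa> $$ (i, j) = y} = 2"
    using card_round_label[OF r \<open>k \<le> m\<close>] by simp
qed

text \<open>A component meets a pair of rows at most once per period: the pair determines the
  matching by \<open>round_unique\<close>, and then the value \<open>y\<close> determines the
  shift.\<close>

lemma round_robin_periodic:
  assumes "i < 2 * (m + 1)" "i' < 2 * (m + 1)" "i \<noteq> i'" "j < \<kappa>" "j' < \<kappa>"
    and "round_robin m \<kappa> $$ (i, j) = y" "round_robin m \<kappa> $$ (i', j) = y"
    and "round_robin m \<kappa> $$ (i, j') = y" "round_robin m \<kappa> $$ (i', j') = y"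
  shows "j mod ((2 * m + 1) * (m + 1)) = j' mod ((2 * m + 1) * (m + 1))"
proof -
  define r where "r j = j mod (2 * m + 1)" for j
  define s where "s j = j div (2 * m + 1) mod (m + 1)" for j
  have r: "r j < 2 * m + 1" for j
    by (simp add: r_def)
  have s: "s j < m + 1" for j
    unfolding s_def by (rule mod_less_divisor) simp
  have entry: "round_robin m \<kappa> $$ (i, j) = (round_label m (r j) i + s j) mod (m + 1)"
    if "i < 2 * (m + 1)" "j < \<kappa>" for i j
    using that by (simp add: round_robin_def r_def s_def)
  have same: "round_label m (r j) i = round_label m (r j) i'"
    if "j < \<kappa>" "round_robin m \<kappa> $$ (i, j) = y" "round_robin m \<kappa> $$ (i', j) = y" for j
  \<comment> \<open>Here the shift \<open>s j\<close> is the common summand that is cancelled; for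
    \<open>s j = s j'\<close> below it is the label.\<close>
  proof (rule shift_mod_inj)
    show "(s j + round_label m (r j) i) mod (m + 1) = (s j + round_label m (r j) i') mod (m + 1)"
      using that assms(1,2) by (simp add: entry add.commute)
  qed (use round_label_le[OF r assms(1), of j] round_label_le[OF r assms(2), of j] in simp_all)
  have "r j = r j'"
    using round_unique[OF r r assms(1-3)] same assms(4-9) by blast
  moreover have "s j = s j'"
    using shift_mod_inj[OF _ s s] assms(1,4,5,6,8) \<open>r j = r j'\<close> by (metis entry)
  ultimately show ?thesis
    by (simp only: mod_mult2_eq r_def s_def)
qed

lemma overall_overlap_round_robin:
  assumes "\<kappa> \<le> c * ((2 * m + 1) * (m + 1))"
  shows "overall_overlap m (round_robin m \<kappa>) \<le> c"
proof -
  define N where "N = (2 * m + 1) * (m + 1)"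
  have "card {j. j < \<kappa> \<and> round_robin m \<kappa> $$ (i, j) = y \<and> round_robin m \<kappa> $$ (i', j) = y} \<le> c"
    (is "card ?J \<le> c") if "i < 2 * (m + 1)" "i' < 2 * (m + 1)" "i \<noteq> i'" for y i i'
  proof -
    \<comment> \<open>Columns in \<open>?J\<close> lie in different periods, and the
      \<open>\<kappa>\<close> columns meet at most \<open>c\<close> periods.\<close>
    have "inj_on (\<lambda>j. j div N) ?J"
    proof (rule inj_onI)
      fix j j'
      assume "j \<in> ?J" "j' \<in> ?J" and div: "j div N = j' div N"
      then have "j mod N = j' mod N"
        unfolding N_def using round_robin_periodic[OF that] by blast
      with div show "j = j'"
        by (metis div_mult_mod_eq)
    qed
    moreover have "(\<lambda>j. j div N) ` ?J \<subseteq> {..<c}"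
      using assms less_le_trans by (fastforce simp only: N_def[symmetric] image_subset_iff
          mem_Collect_eq lessThan_iff intro: less_mult_imp_div_less)
    ultimately show ?thesis
      using card_inj_on_le[of _ ?J "{..<c}"] by simp
  qed
  moreover have "round_robin m \<kappa> \<in> carrier_mat (2 * (m + 1)) \<kappa>"
    by (simp add: round_robin_def)
  ultimately show ?thesis
    by (simp add: overall_overlap_le_iff)
qed

theorem theorem1:
  fixes m \<kappa> \<gamma> :: nat
  assumes "\<kappa> \<ge> 1" and "\<gamma> = 2 * (m + 1)"
  shows "is_minimum {int (overall_overlap m PM) | PM. balanced_partitioning m \<gamma> \<kappa> PM}
           \<lceil>real \<kappa> / real (\<gamma> choose 2)\<rceil>"
proof -
  define c where "c = nat \<lceil>real \<kappa> / real (\<gamma> choose 2)\<rceil>"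
  have N: "\<gamma> choose 2 = (2 * m + 1) * (m + 1)"
    by (simp add: assms(2) choose_two algebra_simps)
  have pos: "0 < real (\<gamma> choose 2)"
    by (simp only: N of_nat_0_less_iff) simp
  have c: "int c = \<lceil>real \<kappa> / real (\<gamma> choose 2)\<rceil>"
  proof -
    \<comment> \<open>This is the condition for a nonnegative ceiling, so \<open>nat\<close> in
      \<open>c\<close> loses nothing.\<close>
    have "-1 < real \<kappa> / real (\<gamma> choose 2)"
      by (rule less_le_trans[of _ 0]) simp_all
    then show ?thesis
      by (simp add: c_def)
  qed
  \<comment> \<open>Used twice: with \<open>t\<close> the overlap for the lower bound, and with
    \<open>t = c\<close> to see that \<open>c\<close> periods cover all columns.\<close>
  have c_le_iff: "c \<le> t \<longleftrightarrow> \<kappa> \<le> t * (\<gamma> choose 2)" for t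
  proof -
    have "c \<le> t \<longleftrightarrow> real \<kappa> / real (\<gamma> choose 2) \<le> real t"
      unfolding c_def by (simp add: nat_le_iff ceiling_le_iff)
    also have "\<dots> \<longleftrightarrow> real \<kappa> \<le> real (t * (\<gamma> choose 2))"
      using pos by (simp add: pos_divide_le_eq)
    finally show ?thesis
      by (simp only: of_nat_le_iff)
  qed
  have lower: "c \<le> overall_overlap m PM" if "balanced_partitioning m \<gamma> \<kappa> PM" for PM
    using columns_le_overall_overlap[OF that] assms(2) by (simp add: c_le_iff)
  have balanced: "balanced_partitioning m \<gamma> \<kappa> (round_robin m \<kappa>)"
    unfolding assms(2) by (rule balanced_round_robin)
  have "overall_overlap m (round_robin m \<kappa>) \<le> c"
    using c_le_iff[of c] by (intro overall_overlap_round_robin) (simp add: N)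
  with lower[OF balanced] have "overall_overlap m (round_robin m \<kappa>) = c"
    by simp
  with balanced lower show ?thesis
    unfolding is_minimum_def c[symmetric] by auto
qed

end
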